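(* For each $l\ge1$ let $\kappa_1^l,\kappa_2^l,\dots,\kappa_{2^l}^l$ be the reduced continued fraction expansions (finite blocks of digits) of the $2^l$ rationals in the $l$-th level of the Kepler tree, ordered from left to right. For every $l\in\mathbb{N}$ let $\pi_l$ be a permutation of $\{1,2,\dots,2^l\}$. Let $\mathcal{K}^{\pi}$ be the number whose infinite continued fraction digit sequence is the concatenation $$\mathcal{K}^{\pi} := [\kappa_{\pi_1(1)}^1,\ \kappa_{\pi_1(2)}^1,\ \kappa_{\pi_2(1)}^2,\ \kappa_{\pi_2(2)}^2,\ \kappa_{\pi_2(3)}^2,\ \kappa_{\pi_2(4)}^2,\ \kappa_{\pi_3(1)}^3,\ \cdots].$$ Then $\mathcal{K}^{\pi}$ is Minkowski normal.
   Context: $\mathbb{N}=\{1,2,3,\dots\}$. Continued fractions: $[a_1,a_2,a_3,\cdots]$ denotes the (finite or infinite) regular continued fraction $\cfrac{1}{a_1+\cfrac{1}{a_2+\cfrac{1}{a_3+\ddots}}}$ with digits $a_i\in\mathbb{N}$. Every rational in $(0,1)$ is written in its reduced form $[a_1,\dots,a_n]$ with $a_n\ge 2$, which is unique. Kepler tree: the infinite binary tree with root $\frac12$ (level $0$) in which every node $p/q$ has left child $p/(p+q)$ and right child $q/(p+q)$. Equivalently, in continued fraction form, the root is $[2]$ and the node $[a_1,a_2,\dots,a_n]$ has left child $[a_1+1,a_2,\dots,a_n]$ and right child $[1,a_1,a_2,\dots,a_n]$. Level $l$ has $2^l$ nodes. Minkowski normality: for $x=[a_1,a_2,a_3,\cdots]\in[0,1)$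 with infinite continued fraction expansion and a block $d=d_1,d_2,\dots,d_k$ of digits $d_i\in\mathbb{N}$, let $G_n(x,d)$ denote the number of occurrences of $d$ as a block of consecutive digits in the first $n$ digits $a_1,\dots,a_n$ (the number of $i$ with $1\le i\le n-k+1$ and $a_{i+j-1}=d_j$ for all $1\le j\le k$). The number $x$ is Minkowski normal if for every $k\ge1$ and every block $d=d_1,\dots,d_k$ with $d_i\in\mathbb{N}$, $$\lim_{n\to\infty}\frac1n G_n(x,d)=2^{-(d_1+d_2+\cdots+d_k)}.$$ *)

theory Defs
  imports Complex_Main "HOL-Library.Stream" "HOL-Combinatorics.Permutations"
begin

fun cf_value :: "nat list \<Rightarrow> real" where
  "cf_value [] = 0"
| "cf_value (d # ds) = 1 / (real d + cf_value ds)"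

definition inf_cf_value :: "nat stream \<Rightarrow> real" where
  "inf_cf_value a = lim (\<lambda>n. cf_value (stake n a))"

definition has_inf_cf :: "real \<Rightarrow> nat stream \<Rightarrow> bool" where
  "has_inf_cf x a \<longleftrightarrow> (\<forall>n. a !! n \<ge> 1) \<and> (\<lambda>n. cf_value (stake n a)) \<longlonglongrightarrow> x"

definition is_reduced_cf :: "real \<Rightarrow> nat list \<Rightarrow> bool" where
  "is_reduced_cf r ds \<longleftrightarrow>
     ds \<noteq> [] \<and> (\<forall>d \<in> set ds. d \<ge> 1) \<and> last ds \<ge> 2 \<and> cf_value ds = r"

definition reduced_cf :: "real \<Rightarrow> nat list" where
  "reduced_cf r = (THE ds. is_reduced_cf r ds)"

text \<open>The \<open>l\<close>-th level of the Kepler tree from left to right; a pair \<open>(p, q)\<close> stands for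
  the node \<open>p/q\<close>.\<close>

fun kepler_level :: "nat \<Rightarrow> (nat \<times> nat) list" where
  "kepler_level 0 = [(1, 2)]"
| "kepler_level (Suc l) = concat (map (\<lambda>(p, q). [(p, p + q), (q, p + q)]) (kepler_level l))"

text \<open>The index \<open>j\<close> runs from \<open>1\<close> to \<open>2 ^ l\<close>.\<close>

definition kepler_cf :: "nat \<Rightarrow> nat \<Rightarrow> nat list" where
  "kepler_cf l j = (case kepler_level l ! (j - 1) of (p, q) \<Rightarrow> reduced_cf (real p / real q))"

text \<open>Level \<open>0\<close> does not contribute to the concatenation.\<close>

definition kepler_digits :: "(nat \<Rightarrow> nat \<Rightarrow> nat) \<Rightarrow> nat stream" where
  "kepler_digits \<pi> =
     flat (smap (\<lambda>l. concat (map (\<lambda>j. kepler_cf l (\<pi> l j)) [1..<2 ^ l + 1])) (fromN 1))"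

definition kepler_number :: "(nat \<Rightarrow> nat \<Rightarrow> nat) \<Rightarrow> real" where
  "kepler_number \<pi> = inf_cf_value (kepler_digits \<pi>)"

text \<open>Positions are counted from \<open>0\<close>, so an occurrence starting at \<open>i\<close> lies within the first
  \<open>n\<close> digits iff \<open>i + length d \<le> n\<close>.\<close>

definition block_count :: "nat stream \<Rightarrow> nat list \<Rightarrow> nat \<Rightarrow> nat" where
  "block_count a d n = card {i. i + length d \<le> n \<and> (\<forall>j < length d. a !! (i + j) = d ! j)}"

text \<open>An infinite expansion is unique if it exists. The first conjunct on \<open>a\<close> excludes the numbers
  without one, for which the second would hold vacuously.\<close>

definition minkowski_normal :: "real \<Rightarrow> bool" where
  "minkowski_normal x \<longleftrightarrow>
     0 \<le> x \<and> x < 1 \<and> (\<exists>a. has_inf_cf x a) \<and>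
     (\<forall>a. has_inf_cf x a \<longrightarrow>
       (\<forall>d. d \<noteq> [] \<and> (\<forall>e \<in> set d. e \<ge> 1) \<longrightarrow>
         (\<lambda>n. real (block_count a d n) / real n) \<longlonglongrightarrow> 1 / 2 ^ sum_list d))"

end

theory Submission
  imports Defs "HOL-Library.Sublist"
begin

text \<open>Choosing a child of a node at random turns the descent in the Kepler tree into a random
  walk on digit blocks. Fix a block \<open>d\<close>. For a node \<open>w\<close>, take the number of occurrences of \<open>d\<close>
  in \<open>w\<close> minus its expected density \<open>2 ^ - sum_list d\<close> times the length of \<open>w\<close>. Adding the
  conditional expectation of the pending occurrences, those which the growing first digit may
  still complete, makes this a martingale with bounded increments. Its second moment over
  level \<open>l\<close> is therefore \<open>O(l)\<close>, so that the blocks of level \<open>l\<close> have total deviation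
  \<open>O(2 ^ l * sqrt l)\<close> in whichever order they are written, while their total length is of order
  \<open>2 ^ l * l\<close>. Occurrences across the boundaries of blocks contribute only \<open>O(2 ^ l)\<close>.\<close>

subsection \<open>Continued fractions\<close>

lemma cf_value_bounds:
  assumes "\<forall>d\<in>set ds. d \<ge> 1"
  shows "0 \<le> cf_value ds \<and> cf_value ds \<le> 1"
  using assms by (induction ds) (auto simp: divide_simps)

text \<open>Among words of positive digits only \<open>[1]\<close> has the value 1, and a last digit
  of at least 2 excludes it.\<close>

lemma cf_value_less_1:
  assumes "\<forall>d\<in>set ds. d \<ge> 1" "ds \<noteq> [] \<Longrightarrow> last ds \<ge> 2"
  shows "cf_value ds < 1"
  using assms
proof (induction ds)
  case (Cons d ds)
  show ?case
  proof (cases ds)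
    case Nil
    then show ?thesis using Cons.prems by simp
  next
    case (Cons e es)
    have "0 \<le> cf_value es" "e \<ge> 1"
      using Cons.prems Cons cf_value_bounds[of es] by auto
    then have "cf_value ds > 0" using Cons by simp
    moreover have "d \<ge> 1" using Cons.prems by simp
    ultimately show ?thesis by simp
  qed
qed simp

text \<open>The digit is the integer part of the reciprocal; this needs both remainders to be
  strictly below 1.\<close>

lemma first_digit_unique:
  assumes "1 / (real d + u) = 1 / (real e + v)" "0 \<le> u" "u < 1" "0 \<le> v" "v < 1"
  shows "d = e \<and> u = v"
proof -
  have eq: "real d + u = real e + v" using assms(1) by simp
  have "real d < real e + 1" "real e < real d + 1" using eq assms by linarith+
  then have "d = e" by linarith
  then show ?thesis using eq by simp
qed

lemma is_reduced_cf_unique: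
  assumes "is_reduced_cf r ds" "is_reduced_cf r es"
  shows "ds = es"
proof -
  \<comment> \<open>Weaker than \<open>is_reduced_cf\<close> in admitting the empty word, which
    occurs as the tail of a one-digit expansion.\<close>
  let ?P = "\<lambda>ds::nat list. (\<forall>d\<in>set ds. d \<ge> 1) \<and> (ds \<noteq> [] \<longrightarrow> last ds \<ge> 2)"
  have "?P ds \<Longrightarrow> ?P es \<Longrightarrow> cf_value ds = cf_value es \<Longrightarrow> ds = es" for ds es
  proof (induction ds arbitrary: es)
    case Nil
    show ?case
    proof (cases es)
      case (Cons e es')
      then show ?thesis using Nil cf_value_bounds[of es'] by auto
    qed simp
  next
    case (Cons d ds)
    show ?case
    proof (cases es)
      case Nil
      then show ?thesis using Cons.prems cf_value_bounds[of ds] by auto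
    next
      case (Cons e es')
      have P: "?P ds" "?P es'"
        using Cons.prems Cons by (auto split: if_splits)
      have "d = e \<and> cf_value ds = cf_value es'"
      proof (rule first_digit_unique)
        show "1 / (real d + cf_value ds) = 1 / (real e + cf_value es')"
          using Cons.prems Cons by simp
      qed (use P cf_value_bounds cf_value_less_1 in auto)
      then show ?thesis using Cons.IH[of es'] P Cons by auto
    qed
  qed
  then show ?thesis using assms by (auto simp: is_reduced_cf_def)
qed

lemma reduced_cf_eqI: "is_reduced_cf r ds \<Longrightarrow> reduced_cf r = ds"
  unfolding reduced_cf_def using is_reduced_cf_unique by blast

text \<open>One step \<open>1 / (d + u)\<close> has slope -1 at d = 1, u = 0, so it need not
  contract uniformly. Two steps form a Moebius map of determinant 1 whose denominator is at least 2,
  which gives the factor 1/4.\<close>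

lemma two_step_contraction:
  fixes u v d e :: real
  assumes "d \<ge> 1" "e \<ge> 1" "u \<ge> 0" "v \<ge> 0"
  shows "\<bar>1 / (d + 1 / (e + u)) - 1 / (d + 1 / (e + v))\<bar> \<le> \<bar>u - v\<bar> / 4"
proof -
  have *: "1 / (d + 1 / (e + w)) = (e + w) / (d * (e + w) + 1)" if "w \<ge> 0" for w
    using assms that by (simp add: field_simps)
  have ge: "d * (e + w) + 1 \<ge> 2" if "w \<ge> 0" for w
    using mult_mono[of 1 d 1 "e + w"] assms that by simp
  let ?a = "d * (e + u) + 1" and ?b = "d * (e + v) + 1"
  have pos: "?a > 0" "?b > 0" using ge[of u] ge[of v] assms by linarith+
  have "(e + u) / ?a - (e + v) / ?b = (u - v) / (?a * ?b)"
    using pos by (simp add: diff_frac_eq) (simp add: algebra_simps)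
  moreover have "4 \<le> ?a * ?b"
    using mult_mono[OF ge[of u] ge[of v]] assms pos by simp
  moreover have "\<bar>(u - v) / (?a * ?b)\<bar> = \<bar>u - v\<bar> / (?a * ?b)"
    using pos by (simp add: abs_mult)
  moreover have "\<dots> \<le> \<bar>u - v\<bar> / 4"
    using calculation(2) by (intro divide_left_mono) auto
  ultimately show ?thesis using assms by (simp only: *)
qed

text \<open>A factor 4 per pair of digits amounts to 2 per digit. The constant 2 accommodates a
  prefix of length 1, where only the trivial bound 1 is available.\<close>

lemma cf_value_common_prefix:
  assumes "\<forall>d\<in>set (xs @ ys @ zs). d \<ge> 1"
  shows "\<bar>cf_value (xs @ ys) - cf_value (xs @ zs)\<bar> \<le> 2 / 2 ^ length xs"
  using assms
proof (induction xs rule: induct_list012)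
  case 1
  then show ?case using cf_value_bounds[of ys] cf_value_bounds[of zs] by auto
next
  case (2 x)
  then show ?case using cf_value_bounds[of "x # ys"] cf_value_bounds[of "x # zs"] by (auto simp del: cf_value.simps)
next
  case (3 x y xs)
  have "\<bar>cf_value ((x # y # xs) @ ys) - cf_value ((x # y # xs) @ zs)\<bar>
      \<le> \<bar>cf_value (xs @ ys) - cf_value (xs @ zs)\<bar> / 4"
    using two_step_contraction[of x y "cf_value (xs @ ys)" "cf_value (xs @ zs)"]
      cf_value_bounds[of "xs @ ys"] cf_value_bounds[of "xs @ zs"] 3 by auto
  also have "\<dots> \<le> (2 / 2 ^ length xs) / 4"
    using 3 by (intro divide_right_mono) auto
  finally show ?case by simp
qed

section \<open>Infinite expansions: convergence, range, uniqueness\<close>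

lemma ball_set_stake:
  assumes "\<forall>n. P (a !! n)"
  shows "\<forall>x\<in>set (stake n a). P x"
  using assms by (induction n arbitrary: a) (simp, metis set_ConsD snth.simps stake.simps(2))

lemma convergent_cf_value:
  assumes "\<forall>n. a !! n \<ge> 1"
  shows "convergent (\<lambda>n. cf_value (stake n a))"
proof -
  have ge: "\<forall>d\<in>set (stake n (sdrop m a)). d \<ge> 1" for n m
    by (rule ball_set_stake) (use assms in \<open>simp add: sdrop_snth\<close>)
  have "Cauchy (\<lambda>n. cf_value (stake n a))"
  proof (rule metric_CauchyI)
    fix e :: real assume "e > 0"
    have lim: "(\<lambda>n. 2 / 2 ^ n :: real) \<longlonglongrightarrow> 0"
      by (rule LIMSEQ_divide_realpow_zero) simp
    then obtain N where N: "2 / 2 ^ N < e"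
      using order_tendstoD(2)[OF lim \<open>e > 0\<close>] unfolding eventually_sequentially by blast
    have "dist (cf_value (stake m a)) (cf_value (stake n a)) < e" if "m \<ge> N" "n \<ge> N" for m n
    proof -
      have split: "stake k a = stake N a @ stake (k - N) (sdrop N a)" if "k \<ge> N" for k
        using that by (simp add: stake_add)
      have "\<bar>cf_value (stake m a) - cf_value (stake n a)\<bar> \<le> 2 / 2 ^ length (stake N a)"
        unfolding split[OF \<open>m \<ge> N\<close>] split[OF \<open>n \<ge> N\<close>]
        by (rule cf_value_common_prefix) (use ge ge[of N 0] in auto)
      then show ?thesis using N by (simp add: dist_real_def)
    qed
    then show "\<exists>M. \<forall>m\<ge>M. \<forall>n\<ge>M. dist (cf_value (stake m a)) (cf_value (stake n a)) < e"
      by blast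
  qed
  then show ?thesis by (rule Cauchy_convergent)
qed

lemma has_inf_cf_inf_cf_value:
  assumes "\<forall>n. a !! n \<ge> 1"
  shows "has_inf_cf (inf_cf_value a) a"
  using convergent_cf_value[OF assms] assms
  by (auto simp: has_inf_cf_def inf_cf_value_def convergent_LIMSEQ_iff)

lemma has_inf_cf_stl:
  assumes "has_inf_cf x a"
  obtains y where "has_inf_cf y (stl a)" "x = 1 / (real (shd a) + y)" "0 \<le> y" "y \<le> 1"
proof -
  have a: "\<forall>n. a !! n \<ge> 1" and lim: "(\<lambda>n. cf_value (stake n a)) \<longlonglongrightarrow> x"
    using assms by (auto simp: has_inf_cf_def)
  have stl: "\<forall>n. stl a !! n \<ge> 1" using a by (metis snth.simps(2))
  obtain y where y: "(\<lambda>n. cf_value (stake n (stl a))) \<longlonglongrightarrow> y"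
    using convergent_cf_value[OF stl] by (auto simp: convergent_def)
  have bnd: "0 \<le> cf_value (stake n (stl a)) \<and> cf_value (stake n (stl a)) \<le> 1" for n
    by (rule cf_value_bounds[OF ball_set_stake[OF stl]])
  have y01: "0 \<le> y" "y \<le> 1"
    using LIMSEQ_le_const[OF y, of 0] LIMSEQ_le_const2[OF y, of 1] bnd by auto
  have "shd a \<ge> 1" using a by (metis snth.simps(1))
  then have "(\<lambda>n. 1 / (real (shd a) + cf_value (stake n (stl a)))) \<longlonglongrightarrow> 1 / (real (shd a) + y)"
    using y01 by (intro tendsto_intros y) auto
  moreover have "(\<lambda>n. cf_value (stake (Suc n) a)) \<longlonglongrightarrow> x"
    using lim by (rule LIMSEQ_Suc)
  ultimately have "x = 1 / (real (shd a) + y)"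
    by (intro LIMSEQ_unique) simp_all
  moreover have "has_inf_cf y (stl a)" using y stl by (simp add: has_inf_cf_def)
  ultimately show thesis using that y01 by blast
qed

text \<open>Limits preserve only weak inequalities. Strictness comes from the tails: x is the
  reciprocal of a positive number, and it is below 1 because its tail is positive by the same
  argument.\<close>

lemma has_inf_cf_bounds:
  assumes "has_inf_cf x a"
  shows "0 < x" "x < 1"
proof -
  have pos: "0 < x" if x: "has_inf_cf x a" for x a
  proof -
    obtain y where "x = 1 / (real (shd a) + y)" "0 \<le> y"
      using has_inf_cf_stl[OF x] by metis
    moreover have "shd a \<ge> 1" using x by (metis has_inf_cf_def snth.simps(1))
    ultimately show ?thesis by simp
  qed
  show "0 < x" using assms by (rule pos)
  obtain y where "x = 1 / (real (shd a) + y)" "has_inf_cf y (stl a)"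
    using has_inf_cf_stl[OF assms] by metis
  moreover have "shd a \<ge> 1" using assms by (metis has_inf_cf_def snth.simps(1))
  ultimately show "x < 1" using pos[of y "stl a"] by simp
qed

text \<open>Needed because \<open>minkowski_normal\<close> quantifies over all expansions. Tails lie
  strictly between 0 and 1, so the first digits agree, the tails agree, and the argument
  repeats.\<close>

lemma has_inf_cf_unique:
  assumes "has_inf_cf x a" "has_inf_cf x b"
  shows "a = b"
proof -
  have "a !! n = b !! n" for n
    using assms
  proof (induction n arbitrary: a b x)
    case (0 a b x)
    obtain y z where "has_inf_cf y (stl a)" "x = 1 / (real (shd a) + y)"
      "has_inf_cf z (stl b)" "x = 1 / (real (shd b) + z)"
      using has_inf_cf_stl[OF 0(1)] has_inf_cf_stl[OF 0(2)] by metis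
    then have "shd a = shd b \<and> y = z"
      using has_inf_cf_bounds by (intro first_digit_unique) (auto simp: less_imp_le)
    then show ?case by simp
  next
    case (Suc n a b x)
    obtain y z where "has_inf_cf y (stl a)" "x = 1 / (real (shd a) + y)"
      "has_inf_cf z (stl b)" "x = 1 / (real (shd b) + z)"
      using has_inf_cf_stl[OF Suc(2)] has_inf_cf_stl[OF Suc(3)] by metis
    moreover from this have "shd a = shd b \<and> y = z"
      using has_inf_cf_bounds by (intro first_digit_unique) (auto simp: less_imp_le)
    ultimately show ?case using Suc.IH[of y "stl a" "stl b"] by simp
  qed
  then have "snth a = snth b" by (rule ext)
  then show ?thesis by (metis stream_smap_nats)
qed

subsection \<open>The digit blocks of the Kepler tree\<close>

definition incr_hd :: "nat list \<Rightarrow> nat list" where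
  "incr_hd w = Suc (hd w) # tl w"

lemma length_incr_hd: "w \<noteq> [] \<Longrightarrow> length (incr_hd w) = length w"
  by (cases w) (auto simp: incr_hd_def)

lemma set_incr_hd: "set (incr_hd w) \<subseteq> insert (Suc (hd w)) (set w)"
  by (cases w) (auto simp: incr_hd_def)

text \<open>The tree in its continued fraction form, so that all counting can be done on words
  without fractions.\<close>

fun kepler_words :: "nat \<Rightarrow> nat list list" where
  "kepler_words 0 = [[2]]"
| "kepler_words (Suc l) = concat (map (\<lambda>w. [incr_hd w, 1 # w]) (kepler_words l))"

lemma kepler_words_Suc_sum:
  "sum_list (map f (kepler_words (Suc l))) =
    (\<Sum>w\<leftarrow>kepler_words l. f (incr_hd w) + (f (1 # w) :: 'a :: comm_monoid_add))"
proof -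
  have "sum_list (map f (concat (map (\<lambda>w. [incr_hd w, 1 # w]) ws))) =
    (\<Sum>w\<leftarrow>ws. f (incr_hd w) + f (1 # w))" for ws
    by (induction ws) (auto simp: add_ac)
  then show ?thesis by simp
qed

lemma length_kepler_words: "length (kepler_words l) = 2 ^ l"
  by (induction l) (simp_all add: length_concat comp_def sum_list_triv)

lemma kepler_words_nonempty: "w \<in> set (kepler_words l) \<Longrightarrow> w \<noteq> []"
  by (cases l) (auto simp: incr_hd_def)

lemma kepler_words_ge_1: "w \<in> set (kepler_words l) \<Longrightarrow> \<forall>d\<in>set w. d \<ge> 1"
proof (induction l arbitrary: w)
  case (Suc l)
  then obtain v where v: "v \<in> set (kepler_words l)" "w = incr_hd v \<or> w = 1 # v" by auto
  then show ?case using Suc.IH[OF v(1)] set_incr_hd[of v] by fastforce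
qed simp

lemma length_kepler_word: "w \<in> set (kepler_words l) \<Longrightarrow> length w \<le> Suc l"
proof (induction l arbitrary: w)
  case (Suc l)
  then obtain v where v: "v \<in> set (kepler_words l)" "w = incr_hd v \<or> w = 1 # v" by auto
  then show ?case
    using Suc.IH[OF v(1)] length_incr_hd[OF kepler_words_nonempty[OF v(1)]] by auto
qed simp

text \<open>Only a right step lengthens the word, so the mean length starts at 1 and grows by 1/2
  per level.\<close>

lemma sum_length_kepler_words:
  "(\<Sum>w\<leftarrow>kepler_words l. real (length w)) = 2 ^ l * (1 + real l / 2)"
proof (induction l)
  case (Suc l)
  have "(\<Sum>w\<leftarrow>kepler_words (Suc l). real (length w)) =
      (\<Sum>w\<leftarrow>kepler_words l. 2 * real (length w) + 1)"
    unfolding kepler_words_Suc_sum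
    by (intro arg_cong[where f = sum_list] map_cong)
      (simp_all add: length_incr_hd[OF kepler_words_nonempty[where l = l]])
  also have "\<dots> = 2 * (\<Sum>w\<leftarrow>kepler_words l. real (length w)) + 2 ^ l"
    by (simp add: sum_list_addf sum_list_const_mult sum_list_triv length_kepler_words)
  finally show ?case using Suc by (simp add: algebra_simps)
qed simp

text \<open>The reciprocals of the children are \<open>q/p + 1\<close>, which raises the first
  digit, and \<open>1 + p/q\<close>, which puts a digit 1 in front.\<close>

lemma is_reduced_cf_children:
  assumes "is_reduced_cf (real p / real q) w" "p > 0" "q > 0"
  shows "is_reduced_cf (real p / real (p + q)) (incr_hd w)"
    and "is_reduced_cf (real q / real (p + q)) (1 # w)"
proof -
  obtain a r where w: "w = a # r" using assms by (auto simp: is_reduced_cf_def neq_Nil_conv)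
  have "real a + cf_value r > 0"
    using assms w cf_value_bounds[of r] by (auto simp: is_reduced_cf_def add_pos_nonneg)
  moreover have "1 / (real a + cf_value r) = real p / real q"
    using assms w by (simp add: is_reduced_cf_def)
  ultimately have "real a + cf_value r = real q / real p"
    using assms by (simp add: field_simps)
  then have "real (Suc a) + cf_value r = real (p + q) / real p"
    using assms by (simp add: add_divide_distrib)
  then have "1 / (real (Suc a) + cf_value r) = real p / real (p + q)" by simp
  then show "is_reduced_cf (real p / real (p + q)) (incr_hd w)"
    using assms w by (auto simp: is_reduced_cf_def incr_hd_def split: if_splits)
  show "is_reduced_cf (real q / real (p + q)) (1 # w)"
  proof -
    have "1 + cf_value w = real (p + q) / real q"
      using assms by (simp add: is_reduced_cf_def add_divide_distrib)
    then have "1 / (real 1 + cf_value w) = real q / real (p + q)" by simp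
    then show ?thesis using assms by (auto simp: is_reduced_cf_def)
  qed
qed

section \<open>Passing from fractions and permutations to words\<close>

lemma kepler_level_words:
  "list_all2 (\<lambda>(p, q) w. p > 0 \<and> q > 0 \<and> is_reduced_cf (real p / real q) w)
    (kepler_level l) (kepler_words l)"
proof (induction l)
  case (Suc l)
  have "list_all2 (\<lambda>(p, q) w. p > 0 \<and> q > 0 \<and> is_reduced_cf (real p / real q) w)
      (concat (map (\<lambda>(p, q). [(p, p + q), (q, p + q)]) ps))
      (concat (map (\<lambda>w. [incr_hd w, 1 # w]) ws))"
    if "list_all2 (\<lambda>(p, q) w. p > 0 \<and> q > 0 \<and> is_reduced_cf (real p / real q) w) ps ws"
    for ps ws
    using that
  proof (induction rule: list_all2_induct)
    case (Cons x xs w ws)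
    then show ?case
      using is_reduced_cf_children[of "fst x" "snd x" w] by (auto split: prod.splits)
  qed simp
  then show ?case using Suc by simp
qed (simp add: is_reduced_cf_def)

lemma kepler_cf_eq:
  assumes "j \<in> {1..2 ^ l}"
  shows "kepler_cf l j = kepler_words l ! (j - 1)"
proof -
  have j: "j - 1 < length (kepler_words l)" using assms by (auto simp: length_kepler_words)
  then have "j - 1 < length (kepler_level l)"
    using kepler_level_words[of l] by (simp add: list_all2_lengthD)
  from list_all2_nthD[OF kepler_level_words this] show ?thesis
    by (auto simp: kepler_cf_def intro: reduced_cf_eqI)
qed

text \<open>Later estimates see a level only through its set of words and through sums over them, so
  the order chosen by the permutation disappears here.\<close>

lemma permuted_kepler_level:
  assumes "p permutes {1..2 ^ l}"
  defines "ws \<equiv> map (\<lambda>j. kepler_cf l (p j)) [1..<2 ^ l + 1]"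
  shows "set ws = set (kepler_words l)"
    and "sum_list (map f ws) = (sum_list (map f (kepler_words l)) :: 'a :: comm_monoid_add)"
proof -
  have perm: "bij_betw p {1..2 ^ l} {1..2 ^ l}" using assms(1) by (rule permutes_imp_bij)
  have p_in: "p j \<in> {1..2 ^ l}" if "j \<in> {1..2 ^ l}" for j
    using that perm by (rule bij_betw_apply[rotated])
  have ivl: "{1..<2 ^ l + 1} = {1..2 ^ l :: nat}" by auto
  \<comment> \<open>Tree positions count from 1, list positions from 0.\<close>
  have shift: "bij_betw (\<lambda>j. j - 1) {1..2 ^ l} {..<2 ^ l :: nat}"
    by (rule bij_betw_byWitness[where f' = Suc]) auto
  have "set ws = (\<lambda>j. kepler_cf l (p j)) ` {1..2 ^ l}" by (simp only: ws_def set_map set_upt ivl)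
  also have "\<dots> = (\<lambda>j. kepler_words l ! (j - 1)) ` p ` {1..2 ^ l}"
    unfolding image_image using kepler_cf_eq p_in by (intro image_cong) auto
  also have "\<dots> = (!) (kepler_words l) ` (\<lambda>j. j - 1) ` {1..2 ^ l}"
    using bij_betw_imp_surj_on[OF perm] by (simp add: image_image)
  also have "\<dots> = set (kepler_words l)"
    using bij_betw_imp_surj_on[OF shift]
    by (auto simp: set_conv_nth length_kepler_words image_iff)
  finally show "set ws = set (kepler_words l)" .
  have "sum_list (map f ws) = (\<Sum>j\<in>{1..2 ^ l}. f (kepler_cf l (p j)))"
    by (simp only: ws_def map_map comp_def sum_list_distinct_conv_sum_set[OF distinct_upt]
        set_upt ivl)
  also have "\<dots> = (\<Sum>j\<in>{1..2 ^ l}. f (kepler_words l ! (p j - 1)))"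
    using kepler_cf_eq p_in by (intro sum.cong) auto
  also have "\<dots> = (\<Sum>j\<in>{1..2 ^ l}. f (kepler_words l ! (j - 1)))"
    by (rule sum.reindex_bij_betw[OF perm])
  also have "\<dots> = (\<Sum>j<2 ^ l. f (kepler_words l ! j))"
    by (rule sum.reindex_bij_betw[OF shift])
  also have "\<dots> = sum_list (map f (kepler_words l))"
    by (simp add: sum_list_sum_nth length_kepler_words atLeast0LessThan)
  finally show "sum_list (map f ws) = sum_list (map f (kepler_words l))" .
qed

subsection \<open>Counting occurrences\<close>

fun occ :: "'a list \<Rightarrow> 'a list \<Rightarrow> nat" where
  "occ d [] = 0"
| "occ d (x # xs) = (if prefix d (x # xs) then 1 else 0) + occ d xs"

lemma occ_le_length: "occ d xs \<le> length xs"
  by (induction xs) auto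

lemma occ_append_ge: "occ d xs + occ d ys \<le> occ d (xs @ ys)"
  by (induction xs) (auto dest: prefix_prefix)

lemma occ_append_le: "occ d (xs @ ys) \<le> occ d xs + occ d ys + length d"
proof -
  \<comment> \<open>The minimum makes the induction work: a new occurrence can start at
    \<open>x\<close> only while \<open>x # xs\<close> is shorter than \<open>d\<close>, and then the
    minimum grows by 1.\<close>
  have "occ d (xs @ ys) \<le> occ d xs + occ d ys + min (length xs) (length d)"
  proof (induction xs)
    case (Cons x xs)
    show ?case
    proof (cases "length (x # xs) < length d")
      case False
      then have "prefix d (x # xs) \<longleftrightarrow> prefix d ((x # xs) @ ys)"
        by (metis append_prefixD linorder_not_less prefixI prefix_length_prefix prefix_prefix)
      then show ?thesis using Cons False by auto
    qed (use Cons in auto)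
  qed simp
  then show ?thesis by linarith
qed

lemma card_Collect_nat_split:
  assumes "finite {i. P (Suc i)}"
  shows "card {i. P i} = (if P 0 then 1 else 0) + card {i. P (Suc i)}"
proof -
  have "{i. P i} = (if P 0 then {0} else {}) \<union> Suc ` {i. P (Suc i)}"
  proof (rule set_eqI)
    fix i show "i \<in> {i. P i} \<longleftrightarrow> i \<in> (if P 0 then {0} else {}) \<union> Suc ` {i. P (Suc i)}"
      by (cases i) auto
  qed
  moreover have "card (Suc ` {i. P (Suc i)}) = card {i. P (Suc i)}"
    by (rule card_image) simp
  ultimately show ?thesis
    using assms by (auto simp: card_insert_if)
qed

lemma prefix_iff_nth:
  "prefix xs ys \<longleftrightarrow> length xs \<le> length ys \<and> (\<forall>j<length xs. ys ! j = xs ! j)"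
proof
  assume "length xs \<le> length ys \<and> (\<forall>j<length xs. ys ! j = xs ! j)"
  then have "take (length xs) ys = xs" by (intro nth_equalityI) auto
  then show "prefix xs ys" by (metis take_is_prefix)
qed (auto simp: prefix_def nth_append)

text \<open>For empty \<open>d\<close> the two sides would be \<open>n + 1\<close> and
  \<open>n\<close>.\<close>

lemma block_count_eq_occ:
  assumes "d \<noteq> []"
  shows "block_count a d n = occ d (stake n a)"
proof (induction n arbitrary: a)
  case 0
  then show ?case using assms by (simp add: block_count_def)
next
  case (Suc n)
  let ?P = "\<lambda>i. i + length d \<le> Suc n \<and> (\<forall>j < length d. a !! (i + j) = d ! j)"
  have "finite {i. ?P (Suc i)}" by (rule finite_subset[of _ "{..n}"]) auto
  then have "card {i. ?P i} = (if ?P 0 then 1 else 0) + card {i. ?P (Suc i)}"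
    by (rule card_Collect_nat_split)
  moreover have "card {i. ?P (Suc i)} = block_count (stl a) d n"
    by (simp add: block_count_def)
  moreover have "?P 0 \<longleftrightarrow> prefix d (stake (Suc n) a)"
  proof -
    have "stake (Suc n) a ! j = a !! j" if "length d \<le> Suc n" "j < length d" for j
      by (rule stake_nth) (use that in linarith)
    then show ?thesis by (auto simp: prefix_iff_nth simp del: stake.simps)
  qed
  ultimately show ?case using Suc by (simp add: block_count_def)
qed

text \<open>Centred by the full length rather than by the number of possible starting positions, so
  that the subtracted term is additive under concatenation.\<close>

definition dev :: "nat list \<Rightarrow> nat list \<Rightarrow> real" where
  "dev d xs = real (occ d xs) - real (length xs) / 2 ^ sum_list d"

lemma dev_append: "\<bar>dev d (xs @ ys)\<bar> \<le> \<bar>dev d xs\<bar> + \<bar>dev d ys\<bar> + real (length d)"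
  using occ_append_ge[of d xs ys] occ_append_le[of d xs ys]
  by (simp add: dev_def add_divide_distrib)

lemma abs_dev_le_length: "\<bar>dev d xs\<bar> \<le> real (length xs)"
proof -
  have "real (length xs) / 2 ^ sum_list d \<le> real (length xs)"
    by (simp add: divide_le_eq mult_le_cancel_left1)
  moreover have "0 \<le> real (length xs) / 2 ^ sum_list d" by simp
  ultimately show ?thesis using occ_le_length[of d xs] unfolding dev_def by linarith
qed

text \<open>Each complete word pays its own deviation and \<open>length d\<close> for occurrences
  across its boundary; the one word that is cut pays at most its length.\<close>

lemma dev_prefix_concat:
  assumes "prefix xs (concat ws)" "\<forall>w\<in>set ws. length w \<le> B"
  shows "\<bar>dev d xs\<bar> \<le> (\<Sum>w\<leftarrow>ws. \<bar>dev d w\<bar> + real (length d)) + real B"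
  using assms
proof (induction ws arbitrary: xs)
  case Nil
  then show ?case by (simp add: dev_def)
next
  case (Cons w ws)
  have nonneg: "0 \<le> (\<Sum>w\<leftarrow>ws. \<bar>dev d w\<bar> + real (length d))"
    by (rule sum_list_nonneg) auto
  from Cons.prems(1) have "prefix xs w \<or> (\<exists>ys. xs = w @ ys \<and> prefix ys (concat ws))"
    by (auto simp: prefix_append)
  then show ?case
  proof
    assume "prefix xs w"
    then have "\<bar>dev d xs\<bar> \<le> real B"
      using abs_dev_le_length[of d xs] prefix_length_le[of xs w] Cons.prems(2) by force
    then show ?thesis using nonneg by simp
  next
    assume "\<exists>ys. xs = w @ ys \<and> prefix ys (concat ws)"
    then obtain ys where "xs = w @ ys" "prefix ys (concat ws)" by blast
    then show ?thesis
      using Cons.IH[of ys] Cons.prems(2) dev_append[of d w ys] by auto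
  qed
qed

subsection \<open>A martingale along the tree\<close>

text \<open>The \<open>j\<close>-th summand is the probability that the random walk extends \<open>w\<close> to an occurrence of
  \<open>d\<close> in which the first digit of \<open>w\<close>, once it has stopped growing, plays the role of \<open>d ! j\<close>.\<close>

definition pending :: "nat list \<Rightarrow> nat list \<Rightarrow> real" where
  "pending d w = (\<Sum>j<length d. if hd w \<le> d ! j \<and> prefix (drop (Suc j) d) (tl w)
     then 2 ^ hd w / 2 ^ Suc (sum_list (take (Suc j) d)) else 0)"

text \<open>The first digit may still grow, so only occurrences in \<open>tl w\<close> are settled;
  those involving the head are accounted for by \<open>pending\<close>.\<close>

definition mart :: "nat list \<Rightarrow> nat list \<Rightarrow> real" where
  "mart d w = real (occ d (tl w)) + pending d w - real (length w) / 2 ^ sum_list d"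

text \<open>Each summand is a probability.\<close>

lemma pending_bounds: "0 \<le> pending d w" "pending d w \<le> real (length d)"
proof -
  show "0 \<le> pending d w" unfolding pending_def by (intro sum_nonneg) auto
  have "pending d w \<le> (\<Sum>j<length d. 1)"
    unfolding pending_def
  proof (intro sum_mono)
    fix j assume "j \<in> {..<length d}"
    then have "d ! j \<le> sum_list (take (Suc j) d)"
      by (simp add: take_Suc_conv_app_nth)
    then have "(2::real) ^ hd w \<le> 2 ^ Suc (sum_list (take (Suc j) d))" if "hd w \<le> d ! j"
      using that by (intro power_increasing) auto
    then show "(if hd w \<le> d ! j \<and> prefix (drop (Suc j) d) (tl w)
       then 2 ^ hd w / 2 ^ Suc (sum_list (take (Suc j) d)) else 0) \<le> (1::real)"
      by (simp add: divide_le_eq)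
  qed
  then show "pending d w \<le> real (length d)" by simp
qed

text \<open>A right step makes \<open>a\<close> final: this may complete an occurrence, the
  \<open>prefix\<close> term. It also opens a new one, in which the new first digit is to become the
  last digit of \<open>d\<close>; its chance is the constant on the right.\<close>

lemma pending_children:
  assumes "\<forall>e\<in>set d. e \<ge> 1"
  shows "pending d (Suc a # r) + pending d (1 # a # r) + (if prefix d (a # r) then 1 else 0) =
    2 * pending d (a # r) + 1 / 2 ^ sum_list d"
proof -
  \<comment> \<open>\<open>g j\<close> is the chance that \<open>a # r\<close>, with \<open>a\<close> now final, gets extended to \<open>d\<close> by prepending
    the first \<open>j\<close> digits; the sum over the right child is this sum shifted by one.\<close>
  define g :: "nat \<Rightarrow> real" where
    "g j = (if prefix (drop j d) (a # r) then 1 / 2 ^ sum_list (take j d) else 0)" for j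
  have drop: "drop j d = d ! j # drop (Suc j) d" if "j < length d" for j
    using that by (simp add: Cons_nth_drop_Suc)
  have take: "sum_list (take (Suc j) d) = sum_list (take j d) + d ! j" if "j < length d" for j
    using that by (simp add: take_Suc_conv_app_nth)
  \<comment> \<open>The head 1 never exceeds a digit of \<open>d\<close>, and its power 2 cancels
    the \<open>Suc\<close> in the exponent.\<close>
  have "pending d (1 # a # r) = (\<Sum>j<length d. g (Suc j))"
    unfolding pending_def g_def using assms by (intro sum.cong) (auto simp: Suc_le_eq)
  moreover have "g 0 = (if prefix d (a # r) then 1 else 0)" by (simp add: g_def)
  moreover have "g (length d) = 1 / 2 ^ sum_list d" by (simp add: g_def)
  moreover have "(\<Sum>j<length d. g j) + g (length d) = g 0 + (\<Sum>j<length d. g (Suc j))"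
    by (metis sum.lessThan_Suc sum.lessThan_Suc_shift)
  \<comment> \<open>Termwise: if \<open>a < d ! j\<close> only the left child contributes, if
    \<open>a = d ! j\<close> only \<open>g j\<close> does, in both cases twice the summand of the
    parent.\<close>
  moreover have "pending d (Suc a # r) + (\<Sum>j<length d. g j) = 2 * pending d (a # r)"
    unfolding pending_def sum_distrib_left sum.distrib[symmetric] g_def
    by (intro sum.cong) (auto simp: drop take power_add le_Suc_eq)
  ultimately show ?thesis by linarith
qed

lemma mart_children:
  assumes "\<forall>e\<in>set d. e \<ge> 1" "w \<noteq> []"
  shows "mart d (incr_hd w) + mart d (1 # w) = 2 * mart d w"
proof -
  obtain a r where "w = a # r" using assms by (cases w) auto
  then show ?thesis
    using pending_children[OF assms(1), of a r]
    by (simp add: mart_def incr_hd_def add_divide_distrib algebra_simps split: if_splits)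
qed

text \<open>By \<open>mart_children\<close> this difference is twice the step from the parent to the
  left child, so it bounds the martingale increments.\<close>

lemma mart_increment:
  assumes "w \<noteq> []"
  shows "\<bar>mart d (incr_hd w) - mart d (1 # w)\<bar> \<le> real (length d) + 1"
proof -
  obtain a r where w: "w = a # r" using assms by (cases w) auto
  define m where "m = 1 / (2::real) ^ sum_list d"
  have "0 \<le> m" "m \<le> 1" by (simp_all add: m_def)
  moreover have "mart d (incr_hd w) - mart d (1 # w) =
      pending d (Suc a # r) - pending d (1 # a # r) + m - (if prefix d (a # r) then 1 else 0)"
    by (simp add: w mart_def incr_hd_def m_def add_divide_distrib)
  ultimately show ?thesis
    using pending_bounds[of d "Suc a # r"] pending_bounds[of d "1 # a # r"] by auto
qed

lemma mart_second_moment: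
  assumes "\<forall>e\<in>set d. e \<ge> 1"
  shows "(\<Sum>w\<leftarrow>kepler_words l. (mart d w)\<^sup>2) \<le> 2 ^ l * ((real (length d) + 1)\<^sup>2 * (real l + 1))"
proof (induction l)
  case 0
  define m where "m = 1 / (2::real) ^ sum_list d"
  have "0 \<le> m" "m \<le> 1" by (simp_all add: m_def)
  moreover have "mart d [2] = pending d [2] - m" by (simp add: mart_def m_def)
  ultimately have "\<bar>mart d [2]\<bar> \<le> real (length d) + 1"
    using pending_bounds[of d "[2]"] by auto
  then show ?case by (simp add: abs_le_square_iff[symmetric])
next
  case (Suc l)
  let ?K = "(real (length d) + 1)\<^sup>2"
  have "(\<Sum>w\<leftarrow>kepler_words (Suc l). (mart d w)\<^sup>2) \<le> (\<Sum>w\<leftarrow>kepler_words l. 2 * (mart d w)\<^sup>2 + ?K)"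
    unfolding kepler_words_Suc_sum
  proof (rule sum_list_mono)
    fix w assume "w \<in> set (kepler_words l)"
    then have w: "w \<noteq> []" by (rule kepler_words_nonempty)
    let ?x = "mart d (incr_hd w)" and ?y = "mart d (1 # w)"
    \<comment> \<open>This is the orthogonality of martingale increments: the sum gives the value of
      the parent, the difference the new variance.\<close>
    have parallelogram: "?x\<^sup>2 + ?y\<^sup>2 = ((?x + ?y)\<^sup>2 + (?x - ?y)\<^sup>2) / 2"
      by (simp add: power2_eq_square algebra_simps)
    have "(?x + ?y)\<^sup>2 = 4 * (mart d w)\<^sup>2"
      unfolding mart_children[OF assms w] by (simp add: power_mult_distrib)
    moreover have "\<bar>?x - ?y\<bar> \<le> \<bar>real (length d) + 1\<bar>"
      using mart_increment[OF w, of d] by linarith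
    then have "(?x - ?y)\<^sup>2 \<le> ?K" by (simp only: abs_le_square_iff)
    moreover have "0 \<le> ?K" by (rule zero_le_power2)
    ultimately have "((?x + ?y)\<^sup>2 + (?x - ?y)\<^sup>2) / 2 \<le> 2 * (mart d w)\<^sup>2 + ?K"
      by argo
    then show "?x\<^sup>2 + ?y\<^sup>2 \<le> 2 * (mart d w)\<^sup>2 + ?K"
      unfolding parallelogram .
  qed
  also have "\<dots> = 2 * (\<Sum>w\<leftarrow>kepler_words l. (mart d w)\<^sup>2) + 2 ^ l * ?K"
    by (simp add: sum_list_addf sum_list_const_mult sum_list_triv length_kepler_words)
  \<comment> \<open>Doubling the last term is slack that lets the mean square grow by exactly
    \<open>?K\<close> per level in the bound.\<close>
  also have "\<dots> \<le> 2 * (2 ^ l * (?K * (real l + 1))) + 2 * (2 ^ l * ?K)"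
    using Suc by (intro add_mono) auto
  finally show ?case by (simp add: algebra_simps)
qed

section \<open>From the second moment to the total deviation of a level\<close>

lemma dev_near_mart:
  assumes "w \<noteq> []"
  shows "\<bar>dev d w - mart d w\<bar> \<le> real (length d) + 1"
proof -
  obtain a r where "w = a # r" using assms by (cases w) auto
  then show ?thesis
    using pending_bounds[of d w] by (simp add: dev_def mart_def abs_le_iff)
qed

text \<open>Takes the place of Cauchy-Schwarz when \<open>s\<close> is chosen as the typical size of
  x, below the square root of \<open>l + 1\<close>.\<close>

lemma abs_le_square_div_add:
  fixes x s :: real
  assumes "s > 0"
  shows "\<bar>x\<bar> \<le> x\<^sup>2 * (1 / s) + s"
proof -
  have "2 * \<bar>x\<bar> * s \<le> \<bar>x\<bar>\<^sup>2 + s\<^sup>2" by (rule sum_squares_bound)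
  moreover have "0 \<le> \<bar>x\<bar> * s" using assms by simp
  ultimately have "\<bar>x\<bar> * s \<le> x\<^sup>2 + s\<^sup>2" by simp
  then have "\<bar>x\<bar> \<le> (x\<^sup>2 + s\<^sup>2) / s" using assms by (simp add: pos_le_divide_eq)
  then show ?thesis using assms by (simp add: add_divide_distrib power2_eq_square)
qed

lemma level_deviation:
  assumes "\<forall>e\<in>set d. e \<ge> 1"
  shows "(\<Sum>w\<leftarrow>kepler_words l. \<bar>dev d w\<bar> + real (length d))
    \<le> 2 ^ l * (4 * (real (length d) + 1)\<^sup>2 * sqrt (real l + 1))"
proof -
  let ?k = "real (length d) + 1" and ?s = "sqrt (real l + 1)"
  have s: "?s \<ge> 1" "?s * ?s = real l + 1" by simp_all
  have k: "1 \<le> ?k\<^sup>2" "?k \<le> ?k\<^sup>2" by (auto intro: one_le_power self_le_power)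
  have ptw: "\<bar>dev d w\<bar> + real (length d) \<le> (mart d w)\<^sup>2 * (1 / ?s) + (?s + 2 * ?k)"
    if "w \<in> set (kepler_words l)" for w
  proof -
    \<comment> \<open>One \<open>?k\<close> pays for replacing \<open>dev\<close> by
      \<open>mart\<close>, the other covers the boundary term \<open>length d\<close>.\<close>
    have "\<bar>dev d w\<bar> + real (length d) \<le> \<bar>mart d w\<bar> + 2 * ?k"
      using dev_near_mart[OF kepler_words_nonempty[OF that], of d]
        abs_triangle_ineq2[of "dev d w" "mart d w"] by simp
    also have "\<bar>mart d w\<bar> \<le> (mart d w)\<^sup>2 * (1 / ?s) + ?s"
      by (rule abs_le_square_div_add) (use s in simp)
    finally show ?thesis by (simp only: add.assoc)
  qed
  have "(\<Sum>w\<leftarrow>kepler_words l. \<bar>dev d w\<bar> + real (length d))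
      \<le> (\<Sum>w\<leftarrow>kepler_words l. (mart d w)\<^sup>2 * (1 / ?s) + (?s + 2 * ?k))"
    by (rule sum_list_mono) (rule ptw)
  also have "\<dots> = (\<Sum>w\<leftarrow>kepler_words l. (mart d w)\<^sup>2) * (1 / ?s) + 2 ^ l * (?s + 2 * ?k)"
    by (simp add: sum_list_addf sum_list_mult_const sum_list_triv length_kepler_words algebra_simps
        del: times_divide_eq_right)
  also have "\<dots> \<le> 2 ^ l * (?k\<^sup>2 * (real l + 1)) * (1 / ?s) + 2 ^ l * (?s + 2 * ?k)"
    using mart_second_moment[OF assms] s by (intro add_mono mult_right_mono) auto
  also have "\<dots> = 2 ^ l * (?k\<^sup>2 * ((real l + 1) * (1 / ?s)) + (?s + 2 * ?k))"
    by (simp only: mult.assoc distrib_left[of "2 ^ l"])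
  also have "\<dots> = 2 ^ l * (?k\<^sup>2 * ?s + (?s + 2 * ?k))" by (simp add: real_div_sqrt)
  also have "\<dots> \<le> 2 ^ l * (?k\<^sup>2 * ?s + (?k\<^sup>2 * ?s + 2 * (?k\<^sup>2 * ?s)))"
    using k s mult_mono[of 1 "?k\<^sup>2" ?s ?s] mult_mono[of ?k "?k\<^sup>2" 1 ?s]
    by (intro mult_left_mono add_mono) auto
  finally show ?thesis by (simp add: algebra_simps)
qed

subsection \<open>Concatenation of the levels\<close>

lemma flat_eq_concat_stake:
  assumes "\<forall>xs\<in>sset s. xs \<noteq> []"
  shows "flat s = concat (stake m s) @- flat (sdrop m s)"
  using assms
proof (induction m arbitrary: s)
  case (Suc m)
  have "flat s = shd s @- flat (stl s)"
    using Suc.prems shd_sset by (intro flat_unfold) blast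
  also have "flat (stl s) = concat (stake m (stl s)) @- flat (sdrop m (stl s))"
    using Suc by (metis stl_sset)
  finally show ?case by (simp add: shift_append)
qed simp

lemma prefix_stake_flat:
  assumes "\<forall>xs\<in>sset s. xs \<noteq> []" "n \<le> length (concat (stake m s))"
  shows "prefix (stake n (flat s)) (concat (stake m s))"
proof -
  have "stake n (flat s) = take n (concat (stake m s))"
    by (subst flat_eq_concat_stake[OF assms(1), of m]) (use assms(2) in \<open>simp add: stake_shift\<close>)
  then show ?thesis by (simp add: take_is_prefix)
qed

definition level_words :: "(nat \<Rightarrow> nat \<Rightarrow> nat) \<Rightarrow> nat \<Rightarrow> nat list list" where
  "level_words \<pi> l = map (\<lambda>j. kepler_cf l (\<pi> l j)) [1..<2 ^ l + 1]"

text \<open>Kept as a list of words, not of digits, because \<open>dev_prefix_concat\<close> works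
  word by word.\<close>

definition upto_level :: "(nat \<Rightarrow> nat \<Rightarrow> nat) \<Rightarrow> nat \<Rightarrow> nat list list" where
  "upto_level \<pi> m = concat (map (level_words \<pi>) [1..<Suc m])"

lemma upto_level_Suc: "upto_level \<pi> (Suc m) = upto_level \<pi> m @ level_words \<pi> (Suc m)"
  by (simp add: upto_level_def)

section \<open>Deviation and block frequency for fixed permutations\<close>

context
  fixes \<pi> :: "nat \<Rightarrow> nat \<Rightarrow> nat"
  assumes perm: "\<And>l. l \<ge> 1 \<Longrightarrow> \<pi> l permutes {1..2 ^ l}"
begin

lemma set_level_words: "l \<ge> 1 \<Longrightarrow> set (level_words \<pi> l) = set (kepler_words l)"
  unfolding level_words_def by (rule permuted_kepler_level(1)[OF perm])

lemma sum_level_words: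
  "l \<ge> 1 \<Longrightarrow> sum_list (map f (level_words \<pi> l)) =
    (sum_list (map f (kepler_words l)) :: 'a :: comm_monoid_add)"
  unfolding level_words_def by (rule permuted_kepler_level(2)[OF perm])

lemma level_words_not_Nil:
  assumes "l \<ge> 1"
  shows "concat (level_words \<pi> l) \<noteq> []"
proof -
  have "kepler_words l \<noteq> []" using length_kepler_words[of l] by auto
  then have "hd (kepler_words l) \<in> set (level_words \<pi> l)"
    using set_level_words[OF assms] by simp
  moreover have "hd (kepler_words l) \<noteq> []"
    using kepler_words_nonempty \<open>kepler_words l \<noteq> []\<close> hd_in_set by blast
  ultimately show ?thesis by auto
qed

lemma kepler_digits_eq:
  "kepler_digits \<pi> = flat (smap (\<lambda>l. concat (level_words \<pi> l)) (fromN 1))"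
  by (simp add: kepler_digits_def level_words_def)

lemma sset_kepler_levels: "\<forall>xs\<in>sset (smap (\<lambda>l. concat (level_words \<pi> l)) (fromN 1)). xs \<noteq> []"
  using level_words_not_Nil by (auto simp: stream.set_map)

lemma kepler_digits_ge_1: "kepler_digits \<pi> !! n \<ge> 1"
proof -
  have "kepler_digits \<pi> !! n \<in> sset (kepler_digits \<pi>)" by (rule snth_sset)
  then obtain l w where "l \<ge> 1" "w \<in> set (level_words \<pi> l)" "kepler_digits \<pi> !! n \<in> set w"
    unfolding kepler_digits_eq sset_flat[OF sset_kepler_levels] by (auto simp: stream.set_map)
  then show ?thesis using kepler_words_ge_1 set_level_words by blast
qed

lemma prefix_kepler_digits:
  assumes "n \<le> length (concat (upto_level \<pi> m))"
  shows "prefix (stake n (kepler_digits \<pi>)) (concat (upto_level \<pi> m))"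
proof -
  have "concat (stake m (smap (\<lambda>l. concat (level_words \<pi> l)) (fromN 1))) = concat (upto_level \<pi> m)"
  proof (induction m)
    case (Suc m)
    then show ?case
      by (simp add: stake_Suc upto_level_Suc del: stake.simps)
  qed (simp add: upto_level_def)
  then show ?thesis
    using prefix_stake_flat[OF sset_kepler_levels, of n m] assms by (simp add: kepler_digits_eq)
qed

lemma kepler_digits_deviation:
  assumes d: "\<forall>e\<in>set d. e \<ge> 1" and n: "n \<le> length (concat (upto_level \<pi> m))"
  shows "\<bar>dev d (stake n (kepler_digits \<pi>))\<bar>
    \<le> 2 ^ Suc m * (5 * (real (length d) + 1)\<^sup>2 * sqrt (real m + 1))"
proof -
  let ?k = "(real (length d) + 1)\<^sup>2" and ?s = "sqrt (real m + 1)"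
  let ?S = "\<lambda>ws. \<Sum>w\<leftarrow>ws. \<bar>dev d w\<bar> + real (length d)"
  have len: "\<forall>w\<in>set (upto_level \<pi> m). length w \<le> Suc m"
    using set_level_words length_kepler_word by (fastforce simp: upto_level_def)
  \<comment> \<open>The extra summand reflects \<open>2 + 4 + ... + 2 ^ m = 2 ^ Suc m - 2\<close>
    and makes the induction close.\<close>
  have *: "?S (upto_level \<pi> m) + 2 * (4 * ?k * ?s) \<le> 2 ^ Suc m * (4 * ?k * ?s)"
  proof (induction m)
    case (Suc m)
    let ?x = "4 * ?k * sqrt (real m + 1)" and ?y = "4 * ?k * sqrt (real (Suc m) + 1)"
    have "?x \<le> ?y" by (intro mult_left_mono) auto
    then have "(2 ^ Suc m - 2) * ?x \<le> (2 ^ Suc m - 2) * ?y" by (intro mult_left_mono) auto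
    moreover have "?S (level_words \<pi> (Suc m)) \<le> 2 ^ Suc m * ?y"
      using level_deviation[OF d, of "Suc m"] by (simp add: sum_level_words)
    ultimately show ?case
      using Suc by (simp add: upto_level_Suc algebra_simps)
  qed (simp add: upto_level_def)
  have "?S (upto_level \<pi> m) \<le> 2 ^ Suc m * (4 * ?k * ?s)"
  proof -
    have "0 \<le> 2 * (4 * ?k * ?s)" by simp
    then show ?thesis using * by linarith
  qed
  \<comment> \<open>The cut word has length at most \<open>Suc m\<close>; absorbing it raises the
    constant from 4 to 5.\<close>
  moreover have "real (Suc m) \<le> 2 ^ Suc m * (?k * ?s)"
  proof -
    have "1 \<le> ?k" by (rule one_le_power) simp
    then have "1 * 1 \<le> ?k * ?s" by (intro mult_mono) auto
    moreover have "real (Suc m) \<le> 2 ^ Suc m" 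
      by (rule less_imp_le[OF of_nat_less_two_power])
    ultimately have "real (Suc m) * 1 \<le> 2 ^ Suc m * (?k * ?s)" by (intro mult_mono) auto
    then show ?thesis by (simp only: mult_1_right)
  qed
  ultimately have "\<bar>dev d (stake n (kepler_digits \<pi>))\<bar>
      \<le> 2 ^ Suc m * (4 * ?k * ?s) + 2 ^ Suc m * (?k * ?s)"
    using dev_prefix_concat[OF prefix_kepler_digits[OF n] len, of d] by linarith
  also have "\<dots> = 2 ^ Suc m * (5 * ?k * ?s)"
    by (simp only: distrib_left[symmetric]) simp
  finally show ?thesis .
qed

lemma block_frequency_kepler_digits:
  assumes "d \<noteq> []" and d: "\<forall>e\<in>set d. e \<ge> 1"
  shows "(\<lambda>n. real (block_count (kepler_digits \<pi>) d n) / real n) \<longlonglongrightarrow> 1 / 2 ^ sum_list d"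
proof (rule LIMSEQ_I)
  fix \<epsilon> :: real assume "\<epsilon> > 0"
  define D where "D m = length (concat (upto_level \<pi> m))" for m
  define k where "k = (real (length d) + 1)\<^sup>2"
  have D_Suc: "real (D (Suc m)) = real (D m) + 2 ^ m * (real m + 3)" for m
  proof -
    have "real (length (concat ws)) = (\<Sum>w\<leftarrow>ws. real (length w))" for ws :: "nat list list"
      by (induction ws) auto
    then show ?thesis
      using sum_length_kepler_words[of "Suc m"]
      by (simp add: D_def upto_level_Suc sum_level_words algebra_simps)
  qed
  have "D m < D (Suc m)" for m
  proof -
    have "0 < 2 ^ m * (real m + 3)" by simp
    then show ?thesis using D_Suc[of m] by linarith
  qed
  then have "strict_mono D" by (simp add: strict_mono_Suc_iff)
  \<comment> \<open>The relative deviation will be below \<open>40 * k / sqrt (m + 1)\<close>, where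
    level \<open>m\<close> contains the n-th digit and \<open>40 = 5 * 2 ^ 3\<close>.\<close>
  obtain M :: nat where M: "(40 * k / \<epsilon>)\<^sup>2 < real M" using reals_Archimedean2 by blast
  show "\<exists>n0. \<forall>n\<ge>n0. norm (real (block_count (kepler_digits \<pi>) d n) / real n - 1 / 2 ^ sum_list d) < \<epsilon>"
  proof (intro exI allI impI)
    \<comment> \<open>This threshold forces \<open>m > Suc M\<close>, so that \<open>m - 2\<close>
      is a genuine level index.\<close>
    fix n assume n: "n \<ge> Suc (D (Suc M))"
    define m where "m = (LEAST m. n \<le> D m)"
    have "n \<le> D m"
      unfolding m_def using strict_mono_imp_increasing[OF \<open>strict_mono D\<close>, of n] by (rule LeastI)
    then have "D (Suc M) < D m" using n by linarith
    then have "m > Suc M" using \<open>strict_mono D\<close> by (simp only: strict_mono_less)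
    then obtain i where m: "m = Suc (Suc i)" by (intro that[of "m - 2"]) linarith
    have "D (Suc i) < n"
      using not_less_Least[of "Suc i" "\<lambda>m. n \<le> D m"] m unfolding m_def by simp
    then have "real (D (Suc i)) < real n" by simp
    \<comment> \<open>Level \<open>Suc i\<close>, the last one surely complete, alone has this many
      digits.\<close>
    moreover have "2 ^ i * (real m + 1) \<le> real (D (Suc i))"
      unfolding D_Suc by (simp add: m algebra_simps)
    ultimately have ngt: "2 ^ i * (real m + 1) < real n" by (rule order_le_less_trans[rotated])
    have "n > 0" using n by simp
    let ?s = "sqrt (real m + 1)"
    have "\<bar>dev d (stake n (kepler_digits \<pi>))\<bar> \<le> 2 ^ Suc m * (5 * k * ?s)"
      unfolding k_def by (rule kepler_digits_deviation[OF d]) (use \<open>n \<le> D m\<close> D_def in simp)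
    also have "\<dots> = 2 ^ i * ?s * (40 * k)" by (simp add: m)
    also have "\<dots> < 2 ^ i * ?s * (\<epsilon> * ?s)"
    proof (rule mult_strict_left_mono)
      have "(40 * k / \<epsilon>)\<^sup>2 < real m + 1" using M \<open>m > Suc M\<close> by linarith
      then have "40 * k / \<epsilon> < ?s" by (rule real_less_rsqrt)
      then show "40 * k < \<epsilon> * ?s" using \<open>\<epsilon> > 0\<close> by (simp add: divide_less_eq mult.commute)
    qed simp
    also have "\<dots> = \<epsilon> * (2 ^ i * (real m + 1))" by simp
    also have "\<dots> < \<epsilon> * real n" using ngt \<open>\<epsilon> > 0\<close> by simp
    finally have "\<bar>dev d (stake n (kepler_digits \<pi>))\<bar> / real n < \<epsilon>"
      using \<open>n > 0\<close> by (simp add: divide_less_eq)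
    moreover have "real (block_count (kepler_digits \<pi>) d n) / real n - 1 / 2 ^ sum_list d =
        dev d (stake n (kepler_digits \<pi>)) / real n"
      using \<open>n > 0\<close> by (simp add: block_count_eq_occ[OF assms(1)] dev_def diff_divide_distrib)
    ultimately show "norm (real (block_count (kepler_digits \<pi>) d n) / real n - 1 / 2 ^ sum_list d) < \<epsilon>"
      by simp
  qed
qed

end

theorem theorem5p3:
  fixes \<pi> :: "nat \<Rightarrow> nat \<Rightarrow> nat"
  assumes "\<And>l. l \<ge> 1 \<Longrightarrow> \<pi> l permutes {1..2 ^ l}"
  shows "minkowski_normal (kepler_number \<pi>)"
proof -
  have cf: "has_inf_cf (kepler_number \<pi>) (kepler_digits \<pi>)"
    unfolding kepler_number_def
    using kepler_digits_ge_1[OF assms] by (intro has_inf_cf_inf_cf_value) auto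
  show ?thesis
    unfolding minkowski_normal_def
  proof (intro conjI allI impI)
    show "0 \<le> kepler_number \<pi>" "kepler_number \<pi> < 1"
      using has_inf_cf_bounds[OF cf] by simp_all
    show "\<exists>a. has_inf_cf (kepler_number \<pi>) a" using cf by blast
  next
    fix a and d :: "nat list"
    assume "has_inf_cf (kepler_number \<pi>) a"
    then have "a = kepler_digits \<pi>" using cf by (rule has_inf_cf_unique)
    moreover assume "d \<noteq> [] \<and> (\<forall>e\<in>set d. e \<ge> 1)"
    ultimately show "(\<lambda>n. real (block_count a d n) / real n) \<longlonglongrightarrow> 1 / 2 ^ sum_list d"
      using block_frequency_kepler_digits[OF assms] by simp
  qed
qed

end
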